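(* Let $K\subset\mathbf{R}^n$ be a non-empty compact set. (a) If a Borel probability measure $\mu$ on $\mathbf{R}^n$ has barycenter $\bar x(\mu)$ and vanishes outside $K$, then $$\operatorname{Var}(\mu)\le -|\bar x(\mu)|^2-\phi_K^{**}(\bar x(\mu)).$$ If $\bar x(\mu)\in\operatorname{int}(\operatorname{conv}(K))$, then equality holds in this inequality if and only if $\mu$ vanishes outside the boundary of some closed ball $B$ containing $K$, i.e. if and only if $\mu[K\cap\partial B]=1$ for some closed ball $B\supset K$. (b) Let $B$ be the smallest closed ball containing $K$. Among measures with all barycenters, $\mu\in\mathcal{P}(K)$ maximizes the variance $\operatorname{Var}$ over $\mathcal{P}(K)$ if and only if $\mu[K\cap\partial B]=1$ and $\bar x(\mu)$ is the center of $B$. Moreover, in this case $\operatorname{Var}(\mu)=R^2$, where $R$ is the radius of $B$.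
   Context: $\mathcal{P}(K)$ denotes the set of Borel probability measures on $\mathbf{R}^n$ that vanish outside $K$. For such a measure, $\bar x(\mu):=\int_{\mathbf{R}^n}x\,d\mu(x)$ is the barycenter (mean) and $\operatorname{Var}(\mu):=\int_{\mathbf{R}^n}|x-\bar x(\mu)|^2\,d\mu(x)$ is the variance, with $|\cdot|$ the Euclidean norm. $\operatorname{conv}(K)$ denotes the smallest closed convex set containing $K$, and $\operatorname{int}$ denotes interior. The function $\phi_K:\mathbf{R}^n\to\mathbf{R}\cup\{+\infty\}$ is defined by $\phi_K(x)=-|x|^2$ if $x\in K$ and $\phi_K(x)=+\infty$ if $x\notin K$. For $f:\mathbf{R}^n\to\mathbf{R}\cup\{+\infty\}$, the Legendre-Fenchel transform is $f^*(y):=\sup_{x\in\mathbf{R}^n}\,(y\cdot x-f(x))$ for $y\in\mathbf{R}^n$, and $f^{**}:=(f^* )^*$ is the double transform, viewed as a function on $\mathbf{R}^n$. If the smallest closed ball has radius $0$ (i.e. $K$ is a single point), it is that point and so is its boundary. *)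

theory Defs
  imports "HOL-Probability.Probability"
begin

definition prob_measures_on :: "'a::euclidean_space set \<Rightarrow> 'a measure set" where
  "prob_measures_on K = {\<mu>. prob_space \<mu> \<and> sets \<mu> = sets borel \<and> emeasure \<mu> (- K) = 0}"

definition barycenter :: "'a::euclidean_space measure \<Rightarrow> 'a" where
  "barycenter \<mu> = (\<integral>x. x \<partial>\<mu>)"

definition vector_variance :: "'a::euclidean_space measure \<Rightarrow> real" where
  "vector_variance \<mu> = (\<integral>x. (norm (x - barycenter \<mu>))\<^sup>2 \<partial>\<mu>)"

definition closed_convex_hull :: "'a::euclidean_space set \<Rightarrow> 'a set" where
  "closed_convex_hull K = (\<lambda>S. closed S \<and> convex S) hull K"

definition phi :: "'a::euclidean_space set \<Rightarrow> 'a \<Rightarrow> ereal" where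
  "phi K x = (if x \<in> K then - ereal ((norm x)\<^sup>2) else \<infinity>)"

definition legendre_fenchel :: "('a::euclidean_space \<Rightarrow> ereal) \<Rightarrow> 'a \<Rightarrow> ereal" where
  "legendre_fenchel f y = (SUP x. ereal (y \<bullet> x) - f x)"

text \<open>
  Smallest means of least radius. A radius of 0 is allowed: the ball is then a single point, and
  in a euclidean space (of dimension at least 1 in the library) \<^term>\<open>frontier (cball c 0)\<close>
  is that point.
\<close>

definition smallest_cball :: "'a::euclidean_space set \<Rightarrow> 'a \<Rightarrow> real \<Rightarrow> bool" where
  "smallest_cball K c R \<longleftrightarrow>
     0 \<le> R \<and> K \<subseteq> cball c R \<and> (\<forall>c' R'. 0 \<le> R' \<and> K \<subseteq> cball c' R' \<longrightarrow> R \<le> R')"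

lemma smallest_cball_exists:
  fixes K :: "'a::euclidean_space set"
  assumes "compact K" "K \<noteq> {}"
  shows "\<exists>c R. smallest_cball K c R"
proof -
  obtain x0 where x0: "x0 \<in> K" using assms by blast
  obtain r0 where r0: "K \<subseteq> cball x0 r0"
    using compact_imp_bounded[OF assms(1)] by (metis bounded_any_center subsetI mem_cball)
  have r00: "0 \<le> r0" using x0 r0 by force
  define T where "T = (cball x0 r0 \<times> {0..r0}) \<inter> (\<Inter>x\<in>K. {p. dist (fst p) x \<le> snd p})"
  have "closed (\<Inter>x\<in>K. {p :: 'a \<times> real. dist (fst p) x \<le> snd p})"
    by (intro closed_INT ballI closed_Collect_le continuous_intros)
  then have T: "compact T"
    unfolding T_def by (intro compact_Int_closed compact_Times compact_cball compact_Icc)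
  have "(x0, r0) \<in> T" using r0 r00 by (auto simp: T_def)
  then obtain p where p: "p \<in> T" "\<And>q. q \<in> T \<Longrightarrow> snd p \<le> snd q"
    using continuous_attains_inf[OF T _ continuous_on_snd[OF continuous_on_id]] by fastforce
  have "smallest_cball K (fst p) (snd p)"
    unfolding smallest_cball_def
  proof (intro conjI allI impI)
    show "0 \<le> snd p" "K \<subseteq> cball (fst p) (snd p)" using p(1) by (auto simp: T_def)
    fix c' R' assume *: "0 \<le> R' \<and> K \<subseteq> cball c' R'"
    show "snd p \<le> R'"
    proof (cases "R' \<le> r0")
      case True
      then have "(c', R') \<in> T" using * x0 by (auto simp: T_def dist_commute subset_iff)
      then show ?thesis using p(2) by fastforce
    next
      case False
      then show ?thesis using p(1) by (auto simp: T_def)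
    qed
  qed
  then show ?thesis by blast
qed

lemma smallest_cball_unique:
  fixes K :: "'a::euclidean_space set"
  assumes "K \<noteq> {}" "smallest_cball K c R" "smallest_cball K c' R'"
  shows "c = c'" "R = R'"
proof -
  show R: "R = R'" using assms(2,3) by (meson antisym smallest_cball_def)
  define m where "m = (1/2) *\<^sub>R (c + c')"
  define s where "s = R\<^sup>2 - (norm (c - c'))\<^sup>2 / 4"
  have le: "(dist m x)\<^sup>2 \<le> s" if "x \<in> K" for x
  proof -
    have "dist c x \<le> R" "dist c' x \<le> R"
      using assms(2,3) that R by (auto simp: smallest_cball_def)
    then have "(norm (c - x))\<^sup>2 \<le> R\<^sup>2" "(norm (c' - x))\<^sup>2 \<le> R\<^sup>2"
      by (auto simp: dist_norm intro: power_mono)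
    moreover have "(norm (m - x))\<^sup>2 =
        (norm (c - x))\<^sup>2 / 2 + (norm (c' - x))\<^sup>2 / 2 - (norm (c - c'))\<^sup>2 / 4"
      unfolding m_def power2_norm_eq_inner
      by (simp add: inner_diff_left inner_diff_right inner_add_left inner_add_right
          inner_commute field_simps)
    ultimately show ?thesis by (simp add: s_def dist_norm)
  qed
  obtain x where "x \<in> K" using assms(1) by blast
  then have s0: "0 \<le> s" using le[of x] by (meson order_trans zero_le_power2)
  have "K \<subseteq> cball m (sqrt s)" using le by (simp add: real_le_rsqrt subset_iff)
  then have "R \<le> sqrt s"
    using assms(2) s0 by (auto simp: smallest_cball_def)
  then have "R\<^sup>2 \<le> s"
    using assms(2) s0 by (metis smallest_cball_def real_sqrt_pow2 power_mono)
  then show "c = c'" by (simp add: s_def)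
qed

end

theory Submission
  imports Defs
begin

text \<open>
  Everything follows from one estimate. If \<open>K\<close> lies in the ball with center \<open>c\<close> and radius \<open>r\<close>,
  then a measure on \<open>K\<close> has second moment at most \<open>r\<^sup>2\<close> about \<open>c\<close>, with equality exactly when it lives
  on the sphere. By the parallel axis theorem this second moment is the variance plus the squared
  distance from \<open>c\<close> to the barycenter \<open>z\<close>, so the variance is at most \<open>r\<^sup>2 - |z - c|\<^sup>2\<close>
  (\<open>variance_in_ball\<close>).

  For (a), put \<open>D c\<close> for the greatest squared distance from \<open>c\<close> to \<open>K\<close>, the best possible \<open>r\<^sup>2\<close>.
  Completing squares, with slopes written as \<open>-2c\<close>, turns the double transform into the supremum over
  \<open>c\<close> of \<open>|z - c|\<^sup>2 - |z|\<^sup>2 - D c\<close> (\<open>biconjugate_phi\<close>). The claimed upper bound is therefore the infimum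
  of \<open>D c - |z - c|\<^sup>2\<close>, the best bound that the estimate gives over all balls. If \<open>z\<close> is interior to the
  hull, this function of \<open>c\<close> is continuous and grows at least linearly, so the infimum is attained
  (\<open>farthest_sq_gap_attains_inf\<close>); equality in the bound is then equality in the estimate for the
  optimal ball.

  For (b), the estimate in the smallest ball, of center \<open>c\<close> and radius \<open>R\<close>, bounds every variance by
  \<open>R\<^sup>2\<close>, and equality means mass on the sphere and barycenter \<open>c\<close>. It remains to see that the bound is
  reached: \<open>c\<close> is a convex combination of points of \<open>K\<close> on the sphere, since otherwise the ball could
  be shifted and shrunk (\<open>center_in_hull_of_contact_points\<close>), and the weights of the combination are
  the required measure.
\<close>

section \<open>Variance in a ball\<close>

lemma prob_measures_onD:
  assumes "\<mu> \<in> prob_measures_on K" "closed K"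
  shows "prob_space \<mu>" "sets \<mu> = sets borel" "space \<mu> = UNIV" "AE x in \<mu>. x \<in> K"
proof -
  show "prob_space \<mu>" and s: "sets \<mu> = sets borel"
    using assms by (auto simp: prob_measures_on_def)
  show sp: "space \<mu> = UNIV" using sets_eq_imp_space_eq[OF s] by simp
  have "- K \<in> sets \<mu>" "emeasure \<mu> (- K) = 0"
    using assms s by (auto simp: prob_measures_on_def)
  then show "AE x in \<mu>. x \<in> K"
    by (intro AE_I[of _ _ "- K"]) auto
qed

lemma integrable_continuous_on_compact_support:
  fixes f :: "'a::euclidean_space \<Rightarrow> 'b::{banach,second_countable_topology}"
  assumes "\<mu> \<in> prob_measures_on K" "compact K" "continuous_on UNIV f"
  shows "integrable \<mu> f"
proof -
  note P = prob_measures_onD[OF assms(1) compact_imp_closed[OF assms(2)]]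
  interpret prob_space \<mu> by (rule P(1))
  have "compact (f ` K)"
    using assms(2,3) by (meson compact_continuous_image continuous_on_subset subset_UNIV)
  then obtain B where B: "\<forall>y \<in> f ` K. norm y \<le> B"
    using compact_imp_bounded bounded_iff by metis
  have "f \<in> borel_measurable \<mu>"
    using borel_measurable_continuous_onI[OF assms(3)] measurable_cong_sets[OF P(2) refl] by blast
  then show ?thesis
    using P(4) B by (intro integrable_const_bound[of _ B]) auto
qed

text \<open>The parallel axis theorem: on expanding the square about the barycenter, the cross term
  integrates to zero.\<close>

lemma second_moment_about_point:
  fixes K :: "'a::euclidean_space set"
  assumes "\<mu> \<in> prob_measures_on K" "compact K"
  shows "(\<integral>x. (norm (x - c))\<^sup>2 \<partial>\<mu>) = vector_variance \<mu> + (norm (barycenter \<mu> - c))\<^sup>2"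
proof -
  note P = prob_measures_onD[OF assms(1) compact_imp_closed[OF assms(2)]]
  interpret prob_space \<mu> by (rule P(1))
  note int = integrable_continuous_on_compact_support[OF assms]
  define b where "b = barycenter \<mu>"
  have id: "integrable \<mu> (\<lambda>x. x)" by (intro int continuous_intros)
  have var: "integrable \<mu> (\<lambda>x. (norm (x - b))\<^sup>2)" by (intro int continuous_intros)
  have lin: "integrable \<mu> (\<lambda>x. 2 * ((b - c) \<bullet> (x - b)))" by (intro int continuous_intros)
  have "(\<integral>x. (b - c) \<bullet> (x - b) \<partial>\<mu>) = (b - c) \<bullet> (\<integral>x. x - b \<partial>\<mu>)"
    using id by (intro integral_inner_right) simp
  also have "(\<integral>x. x - b \<partial>\<mu>) = 0"
    using id by (simp add: b_def barycenter_def prob_space)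
  finally have lin0: "(\<integral>x. 2 * ((b - c) \<bullet> (x - b)) \<partial>\<mu>) = 0"
    by simp
  have expand: "(norm (x - c))\<^sup>2 = (norm (x - b))\<^sup>2 + 2 * ((b - c) \<bullet> (x - b)) + (norm (b - c))\<^sup>2" for x
    unfolding power2_norm_eq_inner
    by (simp add: inner_diff_left inner_diff_right inner_commute algebra_simps)
  have "(\<integral>x. (norm (x - c))\<^sup>2 \<partial>\<mu>) =
      (\<integral>x. (norm (x - b))\<^sup>2 + 2 * ((b - c) \<bullet> (x - b)) + (norm (b - c))\<^sup>2 \<partial>\<mu>)"
    by (intro Bochner_Integration.integral_cong refl expand)
  also have "\<dots> = (\<integral>x. (norm (x - b))\<^sup>2 \<partial>\<mu>) + (norm (b - c))\<^sup>2"
    using var lin lin0 by (simp add: prob_space)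
  finally show ?thesis by (simp add: vector_variance_def b_def)
qed

text \<open>The defect is the integral of \<open>r\<^sup>2 - |x - c|\<^sup>2\<close>, which is nonnegative on \<open>K\<close> and vanishes exactly
  on the sphere.\<close>

lemma variance_in_ball:
  fixes K :: "'a::euclidean_space set"
  assumes "\<mu> \<in> prob_measures_on K" "compact K" "0 \<le> r" "K \<subseteq> cball c r"
  shows "vector_variance \<mu> + (norm (barycenter \<mu> - c))\<^sup>2 \<le> r\<^sup>2"
    and "vector_variance \<mu> + (norm (barycenter \<mu> - c))\<^sup>2 = r\<^sup>2 \<longleftrightarrow> (AE x in \<mu>. x \<in> sphere c r)"
proof -
  note P = prob_measures_onD[OF assms(1) compact_imp_closed[OF assms(2)]]
  interpret prob_space \<mu> by (rule P(1))
  note int = integrable_continuous_on_compact_support[OF assms(1,2)]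
  have sq: "integrable \<mu> (\<lambda>x. (norm (x - c))\<^sup>2)" by (intro int continuous_intros)
  have def: "integrable \<mu> (\<lambda>x. r\<^sup>2 - (norm (x - c))\<^sup>2)" by (intro int continuous_intros)
  have eq: "(\<integral>x. r\<^sup>2 - (norm (x - c))\<^sup>2 \<partial>\<mu>)
      = r\<^sup>2 - (vector_variance \<mu> + (norm (barycenter \<mu> - c))\<^sup>2)"
    using sq second_moment_about_point[OF assms(1,2)] by (simp add: prob_space)
  have "0 \<le> r\<^sup>2 - (norm (x - c))\<^sup>2" if "x \<in> K" for x
    using that assms(3,4) by (auto simp: dist_norm norm_minus_commute intro!: power_mono)
  then have nonneg: "AE x in \<mu>. 0 \<le> r\<^sup>2 - (norm (x - c))\<^sup>2"
    using P(4) by auto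
  show "vector_variance \<mu> + (norm (barycenter \<mu> - c))\<^sup>2 \<le> r\<^sup>2"
    using integral_nonneg_AE[OF nonneg] eq by simp
  have sphere: "r\<^sup>2 - (norm (x - c))\<^sup>2 = 0 \<longleftrightarrow> x \<in> sphere c r" for x
    using assms(3) by (auto simp: dist_norm norm_minus_commute power2_eq_iff_nonneg)
  show "vector_variance \<mu> + (norm (barycenter \<mu> - c))\<^sup>2 = r\<^sup>2 \<longleftrightarrow> (AE x in \<mu>. x \<in> sphere c r)"
    using integral_nonneg_eq_0_iff_AE[OF def nonneg] eq sphere by auto
qed

lemma on_sphere_conditions:
  fixes K :: "'a::euclidean_space set"
  assumes "\<mu> \<in> prob_measures_on K" "compact K"
  shows "emeasure \<mu> (- frontier (cball c r)) = 0 \<longleftrightarrow> (AE x in \<mu>. x \<in> sphere c r)"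
    and "emeasure \<mu> (K \<inter> frontier (cball c r)) = 1 \<longleftrightarrow> (AE x in \<mu>. x \<in> sphere c r)"
proof -
  note P = prob_measures_onD[OF assms(1) compact_imp_closed[OF assms(2)]]
  interpret prob_space \<mu> by (rule P(1))
  have "- sphere c r \<in> sets \<mu>" using P(2) by auto
  from AE_iff_measurable[OF this, of "\<lambda>x. x \<in> sphere c r"]
  show "emeasure \<mu> (- frontier (cball c r)) = 0 \<longleftrightarrow> (AE x in \<mu>. x \<in> sphere c r)"
    using P(3) by (auto simp: Compl_eq)
  have meas: "K \<inter> sphere c r \<in> sets \<mu>"
    using P(2) compact_imp_closed[OF assms(2)] by auto
  have "emeasure \<mu> (K \<inter> sphere c r) = 1 \<longleftrightarrow> measure \<mu> (K \<inter> sphere c r) = 1"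
    by (simp add: emeasure_eq_measure)
  also have "\<dots> \<longleftrightarrow> (AE x in \<mu>. x \<in> K \<inter> sphere c r)"
    by (rule AE_in_set_eq_1[OF meas, symmetric])
  also have "\<dots> \<longleftrightarrow> (AE x in \<mu>. x \<in> sphere c r)"
    using P(4) by auto
  finally show "emeasure \<mu> (K \<inter> frontier (cball c r)) = 1 \<longleftrightarrow> (AE x in \<mu>. x \<in> sphere c r)"
    by simp
qed

section \<open>The double transform in terms of farthest distances\<close>

definition farthest_sq :: "'a::euclidean_space set \<Rightarrow> 'a \<Rightarrow> real" where
  "farthest_sq K c = (SUP x\<in>K. (norm (x - c))\<^sup>2)"

lemma farthest_sq_attained:
  fixes K :: "'a::euclidean_space set"
  assumes "compact K" "K \<noteq> {}"
  obtains x where "x \<in> K" "farthest_sq K c = (norm (x - c))\<^sup>2"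
    "\<And>y. y \<in> K \<Longrightarrow> (norm (y - c))\<^sup>2 \<le> farthest_sq K c"
proof -
  have "continuous_on K (\<lambda>x. (norm (x - c))\<^sup>2)" by (intro continuous_intros)
  from continuous_attains_sup[OF assms this] obtain x
    where x: "x \<in> K" "\<And>y. y \<in> K \<Longrightarrow> (norm (y - c))\<^sup>2 \<le> (norm (x - c))\<^sup>2" by blast
  have "farthest_sq K c = (norm (x - c))\<^sup>2"
    unfolding farthest_sq_def using x by (intro cSup_eq_maximum) auto
  then show thesis using x that by simp
qed

lemma subset_cball_farthest_sq:
  fixes K :: "'a::euclidean_space set"
  assumes "compact K" "K \<noteq> {}"
  shows "0 \<le> farthest_sq K c" "K \<subseteq> cball c (sqrt (farthest_sq K c))"
proof -
  obtain x where x: "farthest_sq K c = (norm (x - c))\<^sup>2"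
    "\<And>y. y \<in> K \<Longrightarrow> (norm (y - c))\<^sup>2 \<le> farthest_sq K c"
    using farthest_sq_attained[OF assms, of c] by metis
  show "0 \<le> farthest_sq K c" by (simp add: x(1))
  show "K \<subseteq> cball c (sqrt (farthest_sq K c))"
    using x(2) by (auto simp: dist_norm norm_minus_commute intro!: real_le_rsqrt)
qed

lemma farthest_sq_le:
  fixes K :: "'a::euclidean_space set"
  assumes "compact K" "K \<noteq> {}" "K \<subseteq> cball c r"
  shows "farthest_sq K c \<le> r\<^sup>2"
proof -
  obtain x where x: "x \<in> K" "farthest_sq K c = (norm (x - c))\<^sup>2"
    using farthest_sq_attained[OF assms(1,2), of c] by metis
  have "norm (x - c) \<le> r" using x(1) assms(3) by (auto simp: dist_norm norm_minus_commute)
  then show ?thesis by (simp add: x(2) power_mono)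
qed

text \<open>The slope \<open>-2c\<close> completes the square:
  \<open>-2 c \<bullet> x + |x|\<^sup>2 = |x - c|\<^sup>2 - |c|\<^sup>2\<close>.\<close>

lemma legendre_fenchel_phi:
  fixes K :: "'a::euclidean_space set"
  assumes "compact K" "K \<noteq> {}"
  shows "legendre_fenchel (phi K) (- 2 *\<^sub>R c) = ereal (farthest_sq K c - (norm c)\<^sup>2)"
proof -
  obtain x0 where x0: "x0 \<in> K" "farthest_sq K c = (norm (x0 - c))\<^sup>2"
    "\<And>y. y \<in> K \<Longrightarrow> (norm (y - c))\<^sup>2 \<le> farthest_sq K c"
    using farthest_sq_attained[OF assms, of c] by metis
  have val: "ereal ((- 2 *\<^sub>R c) \<bullet> x) - phi K x = ereal ((norm (x - c))\<^sup>2 - (norm c)\<^sup>2)"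
    if "x \<in> K" for x
  proof -
    have "(- 2 *\<^sub>R c) \<bullet> x + (norm x)\<^sup>2 = (norm (x - c))\<^sup>2 - (norm c)\<^sup>2"
      unfolding power2_norm_eq_inner
      by (simp add: inner_diff_left inner_diff_right inner_commute algebra_simps)
    with that show ?thesis by (simp add: phi_def)
  qed
  show ?thesis
    unfolding legendre_fenchel_def
  proof (rule SUP_eqI)
    fix x :: 'a
    show "ereal ((- 2 *\<^sub>R c) \<bullet> x) - phi K x \<le> ereal (farthest_sq K c - (norm c)\<^sup>2)"
    proof (cases "x \<in> K")
      case True
      then show ?thesis using x0(3) by (simp only: val ereal_less_eq) simp
    next
      case False
      then show ?thesis by (simp add: phi_def)
    qed
  next
    fix y assume "\<And>x. x \<in> UNIV \<Longrightarrow> ereal ((- 2 *\<^sub>R c) \<bullet> x) - phi K x \<le> y"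
    then have "ereal ((- 2 *\<^sub>R c) \<bullet> x0) - phi K x0 \<le> y" by blast
    then show "ereal (farthest_sq K c - (norm c)\<^sup>2) \<le> y"
      using x0(1,2) by (simp only: val)
  qed
qed

text \<open>Every slope has the form \<open>-2c\<close>, so the supremum over slopes becomes one over centers.\<close>

lemma biconjugate_phi:
  fixes K :: "'a::euclidean_space set"
  assumes "compact K" "K \<noteq> {}"
  shows "legendre_fenchel (legendre_fenchel (phi K)) z
    = (SUP c. ereal ((norm (z - c))\<^sup>2 - (norm z)\<^sup>2 - farthest_sq K c))"
proof -
  have "surj (\<lambda>c::'a. - 2 *\<^sub>R c)"
    by (rule surjI[of _ "\<lambda>y. (- 1 / 2) *\<^sub>R y"]) simp
  then have "legendre_fenchel (legendre_fenchel (phi K)) z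
      = (SUP c. ereal (z \<bullet> (- 2 *\<^sub>R c)) - legendre_fenchel (phi K) (- 2 *\<^sub>R c))"
    unfolding legendre_fenchel_def[of "legendre_fenchel (phi K)"]
    by (metis (no_types, lifting) SUP_cong image_image)
  also have "\<dots> = (SUP c. ereal ((norm (z - c))\<^sup>2 - (norm z)\<^sup>2 - farthest_sq K c))"
  proof (intro SUP_cong refl)
    fix c
    have "z \<bullet> (- 2 *\<^sub>R c) - (farthest_sq K c - (norm c)\<^sup>2)
        = (norm (z - c))\<^sup>2 - (norm z)\<^sup>2 - farthest_sq K c"
      unfolding power2_norm_eq_inner
      by (simp add: inner_diff_left inner_diff_right inner_commute algebra_simps)
    then show "ereal (z \<bullet> (- 2 *\<^sub>R c)) - legendre_fenchel (phi K) (- 2 *\<^sub>R c)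
        = ereal ((norm (z - c))\<^sup>2 - (norm z)\<^sup>2 - farthest_sq K c)"
      by (simp only: legendre_fenchel_phi[OF assms] ereal_minus)
  qed
  finally show ?thesis .
qed

text \<open>For fixed \<open>x\<close> the terms quadratic in \<open>c\<close> cancel in \<open>|x - c|\<^sup>2 - |z - c|\<^sup>2\<close>, which leaves an affine
  function of \<open>c\<close> with slope \<open>2 (z - x)\<close>. These slopes are bounded for \<open>x\<close> in \<open>K\<close>, so the supremum
  over \<open>x\<close> is Lipschitz.\<close>

lemma continuous_farthest_sq_gap:
  fixes K :: "'a::euclidean_space set"
  assumes "compact K" "K \<noteq> {}"
  shows "continuous_on UNIV (\<lambda>c. farthest_sq K c - (norm (z - c))\<^sup>2)"
proof -
  have "bounded ((\<lambda>x. x - z) ` K)"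
    using assms(1) by (intro compact_imp_bounded compact_continuous_image continuous_intros)
  then obtain M where M: "M > 0" "\<And>x. x \<in> K \<Longrightarrow> norm (x - z) \<le> M"
    by (auto simp: bounded_pos)
  let ?h = "\<lambda>c. farthest_sq K c - (norm (z - c))\<^sup>2"
  have le: "?h c \<le> ?h c' + (2 * M) * norm (c - c')" for c c'
  proof -
    obtain x where x: "x \<in> K" "farthest_sq K c = (norm (x - c))\<^sup>2"
      using farthest_sq_attained[OF assms, of c] by metis
    have x': "(norm (x - c'))\<^sup>2 \<le> farthest_sq K c'"
      using farthest_sq_attained[OF assms, of c'] x(1) by metis
    have "(norm (x - c))\<^sup>2 - (norm (z - c))\<^sup>2
        = (norm (x - c'))\<^sup>2 - (norm (z - c'))\<^sup>2 + 2 * ((c' - c) \<bullet> (x - z))"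
      unfolding power2_norm_eq_inner
      by (simp add: inner_diff_left inner_diff_right inner_commute algebra_simps)
    moreover have "(c' - c) \<bullet> (x - z) \<le> norm (c - c') * M"
      using norm_cauchy_schwarz[of "c' - c" "x - z"] mult_left_mono[OF M(2)[OF x(1)], of "norm (c - c')"]
      by (simp add: norm_minus_commute)
    ultimately show ?thesis using x(2) x' by (simp add: mult_ac)
  qed
  have "(2 * M)-lipschitz_on UNIV ?h"
  proof (rule lipschitz_onI)
    fix c c' :: 'a
    show "dist (?h c) (?h c') \<le> (2 * M) * dist c c'"
      using le[of c c'] le[of c' c] by (simp add: dist_norm norm_minus_commute abs_le_iff)
  qed (use M in simp)
  then show ?thesis by (rule lipschitz_on_continuous_on)
qed

text \<open>The hull reaches at least \<open>e\<close> beyond \<open>z\<close> in the direction \<open>z - c\<close>, hence so does some point of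
  \<open>K\<close>, since a half-space containing \<open>K\<close> contains the hull. That point is far from \<open>c\<close>.\<close>

lemma farthest_sq_gap_coercive:
  fixes K :: "'a::euclidean_space set"
  assumes "compact K" "K \<noteq> {}" "0 < e" "cball z e \<subseteq> closed_convex_hull K"
  shows "2 * e * norm (z - c) \<le> farthest_sq K c - (norm (z - c))\<^sup>2"
proof (cases "z = c")
  case True
  then show ?thesis using subset_cball_farthest_sq(1)[OF assms(1,2)] by simp
next
  case False
  have "continuous_on K (\<lambda>x. (z - c) \<bullet> x)" by (intro continuous_intros)
  from continuous_attains_sup[OF assms(1,2) this] obtain x
    where x: "x \<in> K" "\<And>y. y \<in> K \<Longrightarrow> (z - c) \<bullet> y \<le> (z - c) \<bullet> x" by blast
  have half: "closed_convex_hull K \<subseteq> {y. (z - c) \<bullet> y \<le> (z - c) \<bullet> x}"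
    unfolding closed_convex_hull_def
    using x(2) by (intro hull_minimal) (auto simp: closed_halfspace_le convex_halfspace_le)
  define u where "u = z + (e / norm (z - c)) *\<^sub>R (z - c)"
  have "u \<in> cball z e" using assms(3) False by (simp add: u_def dist_norm)
  then have "(z - c) \<bullet> u \<le> (z - c) \<bullet> x" using assms(4) half by blast
  moreover have "(z - c) \<bullet> u = (z - c) \<bullet> z + e * norm (z - c)"
    using False by (simp add: u_def inner_add_right power2_eq_square
        flip: power2_norm_eq_inner)
  ultimately have "e * norm (z - c) \<le> (z - c) \<bullet> (x - z)"
    by (simp add: inner_diff_right)
  moreover have "(norm (x - c))\<^sup>2 = (norm (z - c))\<^sup>2 + 2 * ((z - c) \<bullet> (x - z)) + (norm (x - z))\<^sup>2"
    unfolding power2_norm_eq_inner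
    by (simp add: inner_diff_left inner_diff_right inner_commute algebra_simps)
  moreover have "(norm (x - c))\<^sup>2 \<le> farthest_sq K c"
    using farthest_sq_attained[OF assms(1,2), of c] x(1) by metis
  ultimately show ?thesis using zero_le_power2[of "norm (x - z)"] by linarith
qed

lemma farthest_sq_gap_attains_inf:
  fixes K :: "'a::euclidean_space set"
  assumes "compact K" "K \<noteq> {}" "z \<in> interior (closed_convex_hull K)"
  obtains c where "\<And>c'. farthest_sq K c - (norm (z - c))\<^sup>2 \<le> farthest_sq K c' - (norm (z - c'))\<^sup>2"
proof -
  let ?h = "\<lambda>c. farthest_sq K c - (norm (z - c))\<^sup>2"
  obtain e where e: "0 < e" "cball z e \<subseteq> closed_convex_hull K"
    using assms(3) by (auto simp: mem_interior_cball)
  note coercive = farthest_sq_gap_coercive[OF assms(1,2) e]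
  (* Outside this ball coercivity makes the gap larger than its value at z. *)
  define s where "s = ?h z / (2 * e)"
  have "0 \<le> s" using coercive[of z] e(1) by (simp add: s_def)
  then have ball: "compact (cball z s)" "cball z s \<noteq> {}" "z \<in> cball z s" by auto
  have "continuous_on (cball z s) ?h"
    using continuous_farthest_sq_gap[OF assms(1,2)] continuous_on_subset by blast
  from continuous_attains_inf[OF ball(1,2) this] obtain c
    where c: "\<And>c'. c' \<in> cball z s \<Longrightarrow> ?h c \<le> ?h c'" by blast
  have "?h c \<le> ?h c'" for c'
  proof (cases "c' \<in> cball z s")
    case False
    then have "?h z < 2 * e * norm (z - c')"
      using e(1) by (simp add: s_def dist_norm field_simps)
    then show ?thesis using coercive[of c'] c[OF ball(3)] by linarith
  qed (rule c)
  then show thesis by (rule that)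
qed

section \<open>Contact points of the smallest ball\<close>

text \<open>Otherwise a hyperplane separates the center from the contact points, and a small shift of the
  center towards their side brings all of \<open>K\<close> into a smaller ball.\<close>

lemma center_in_hull_of_contact_points:
  fixes K :: "'a::euclidean_space set"
  assumes "compact K" "K \<noteq> {}" "smallest_cball K c R"
  shows "c \<in> convex hull (K \<inter> sphere c R)"
proof (rule ccontr)
  assume notin: "c \<notin> convex hull (K \<inter> sphere c R)"
  have R: "0 \<le> R" "K \<subseteq> cball c R" "\<And>c' R'. 0 \<le> R' \<Longrightarrow> K \<subseteq> cball c' R' \<Longrightarrow> R \<le> R'"
    using assms(3) by (auto simp: smallest_cball_def)
  have "closed (convex hull (K \<inter> sphere c R))"
    using assms(1) by (intro compact_imp_closed compact_convex_hull) (simp add: compact_Int_closed)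
  from separating_hyperplane_closed_point[OF convex_convex_hull this notin] obtain a b
    where a: "a \<bullet> c < b" "\<And>x. x \<in> convex hull (K \<inter> sphere c R) \<Longrightarrow> b < a \<bullet> x" by blast
  define d where "d = b - a \<bullet> c"
  have d: "d > 0" using a by (simp add: d_def)
  have contact: "d < a \<bullet> (x - c)" if "x \<in> K" "norm (x - c) = R" for x
  proof -
    have "x \<in> K \<inter> sphere c R" using that by (simp add: dist_norm norm_minus_commute)
    then show ?thesis using a(2) hull_inc[of x] by (simp add: d_def inner_diff_right)
  qed
  (* By compactness, the points of K on the wrong side of the hyperplane keep a positive
     distance from the sphere. *)
  define L where "L = K \<inter> {x. a \<bullet> (x - c) \<le> d}"
  have "closed {x. a \<bullet> (x - c) \<le> d}"
    by (intro closed_Collect_le continuous_intros)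
  then have L: "compact L" using assms(1) by (simp add: L_def compact_Int_closed)
  have le_R: "norm (x - c) \<le> R" if "x \<in> K" for x
    using R(2) that by (auto simp: dist_norm norm_minus_commute)
  obtain m where m: "m > 0" "\<And>x. x \<in> L \<Longrightarrow> (norm (x - c))\<^sup>2 \<le> R\<^sup>2 - m"
  proof (cases "L = {}")
    case True
    then show thesis using that[of 1] by simp
  next
    case False
    have "continuous_on L (\<lambda>x. (norm (x - c))\<^sup>2)" by (intro continuous_intros)
    from continuous_attains_sup[OF L False this] obtain x
      where x: "x \<in> L" "\<And>y. y \<in> L \<Longrightarrow> (norm (y - c))\<^sup>2 \<le> (norm (x - c))\<^sup>2" by blast
    have "norm (x - c) < R" using x(1) contact[of x] le_R[of x] by (fastforce simp: L_def)
    then have "(norm (x - c))\<^sup>2 < R\<^sup>2" by (simp add: power_strict_mono)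
    then show thesis using that[of "R\<^sup>2 - (norm (x - c))\<^sup>2"] x(2) by simp
  qed
  define N where "N = (norm a)\<^sup>2 + 2 * norm a * R + 1"
  have N: "N \<ge> 1" using R(1) by (simp add: N_def)
  (* The shift of the center by t a changes the squared distance to x by the terms
     - 2 t (a, x - c) + t^2 |a|^2. Beyond the hyperplane the first is at most - 2 t d, and t N \<le> d
     makes the second at most t d. On L the sum is at most t N, as t \<le> 1, and t N \<le> m / 2 spends no
     more than half of the margin m. *)
  define t where "t = min 1 (min (d / N) (m / (2 * N)))"
  have t: "0 < t" "t \<le> 1" "t * N \<le> d" "t * N \<le> m / 2"
    using d m(1) N by (auto simp: t_def min_def field_simps)
  have t2: "t\<^sup>2 * (norm a)\<^sup>2 \<le> t * (norm a)\<^sup>2"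
    using t by (intro mult_right_mono) (auto simp: power2_eq_square mult_left_le)
  have tN: "t * N = t * (norm a)\<^sup>2 + 2 * t * norm a * R + t" by (simp add: N_def algebra_simps)
  have tn: "0 \<le> 2 * t * norm a * R" using t R(1) by simp
  define c' where "c' = c + t *\<^sub>R a"
  define s where "s = R\<^sup>2 - min (t * d) (m / 2)"
  have le: "(norm (x - c'))\<^sup>2 \<le> s" if "x \<in> K" for x
  proof -
    have eq: "(norm (x - c'))\<^sup>2 = (norm (x - c))\<^sup>2 - 2 * t * (a \<bullet> (x - c)) + t\<^sup>2 * (norm a)\<^sup>2"
      unfolding power2_norm_eq_inner c'_def
      by (simp add: inner_diff_left inner_diff_right inner_add_left inner_add_right inner_commute
          power2_eq_square algebra_simps)
    show ?thesis
    proof (cases "x \<in> L")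
      case True
      have "- (a \<bullet> (x - c)) \<le> norm a * R"
        using norm_cauchy_schwarz[of "- a" "x - c"] mult_left_mono[OF le_R[OF that], of "norm a"] by simp
      then have "(2 * t) * (- (a \<bullet> (x - c))) \<le> (2 * t) * (norm a * R)"
        using t(1) by (intro mult_left_mono) auto
      then have "(norm (x - c'))\<^sup>2 \<le> R\<^sup>2 - m + t * N"
        using eq m(2)[OF True] t2 tN t(1) by linarith
      then show ?thesis using t(4) by (simp add: s_def)
    next
      case False
      then have "d \<le> a \<bullet> (x - c)" using that by (simp add: L_def)
      then have "(2 * t) * d \<le> (2 * t) * (a \<bullet> (x - c))"
        using t(1) by (intro mult_left_mono) auto
      moreover have "t\<^sup>2 * (norm a)\<^sup>2 \<le> t * d"
      proof -
        have "t * (norm a)\<^sup>2 \<le> d" using t(1,3) tN tn by linarith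
        then have "t * (t * (norm a)\<^sup>2) \<le> t * d" using t(1) by (intro mult_left_mono) auto
        then show ?thesis by (simp add: power2_eq_square mult.assoc)
      qed
      moreover have "(norm (x - c))\<^sup>2 \<le> R\<^sup>2" using le_R[OF that] by (simp add: power_mono)
      ultimately have "(norm (x - c'))\<^sup>2 \<le> R\<^sup>2 - t * d" using eq by linarith
      then show ?thesis by (simp add: s_def)
    qed
  qed
  obtain x where "x \<in> K" using assms(2) by blast
  then have s: "0 \<le> s" using le order_trans zero_le_power2 by blast
  have "K \<subseteq> cball c' (sqrt s)"
    using le by (auto simp: dist_norm norm_minus_commute intro!: real_le_rsqrt)
  then have "R \<le> sqrt s" using R(3) s by simp
  then have "R\<^sup>2 \<le> s" using R(1) s by (metis power_mono real_sqrt_pow2)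
  moreover have "s < R\<^sup>2" using t(1) d m(1) by (simp add: s_def)
  ultimately show False by simp
qed

text \<open>A convex combination is the barycenter of the discrete measure with the same weights.\<close>

lemma convex_hull_barycenter:
  fixes S :: "'a::euclidean_space set"
  assumes "c \<in> convex hull S"
  obtains \<mu> where "prob_space \<mu>" "sets \<mu> = sets borel" "AE x in \<mu>. x \<in> S" "barycenter \<mu> = c"
proof -
  obtain T u where T: "finite T" "T \<subseteq> S" "\<And>x. x \<in> T \<Longrightarrow> 0 \<le> u x" "sum u T = 1"
    "(\<Sum>x\<in>T. u x *\<^sub>R x) = c"
    using assms unfolding convex_hull_explicit by auto
  define w where "w x = (if x \<in> T then u x else 0)" for x
  have w: "\<And>x. 0 \<le> w x" using T(3) by (simp add: w_def)
  have "(\<integral>\<^sup>+x. ennreal (w x) \<partial>count_space UNIV) = (\<Sum>x\<in>T. ennreal (w x))"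
    using T(1) by (intro nn_integral_count_space') (auto simp: w_def)
  also have "\<dots> = 1" using T(3,4) w by (simp add: sum_ennreal w_def)
  finally have total: "(\<integral>\<^sup>+x. ennreal (w x) \<partial>count_space UNIV) = 1" .
  (* All sets are measurable for a pmf; the push-forward restricts it to the Borel sets. *)
  define p where "p = embed_pmf w"
  have p: "pmf p x = w x" for x unfolding p_def using w total by (rule pmf_embed_pmf)
  have supp: "set_pmf p \<subseteq> T" by (auto simp: set_pmf_iff p w_def split: if_splits)
  define \<mu> where "\<mu> = distr (measure_pmf p) borel (\<lambda>x. x)"
  have "prob_space \<mu>"
    unfolding \<mu>_def by (intro prob_space.prob_space_distr prob_space_measure_pmf) simp
  moreover have "sets \<mu> = sets borel" by (simp add: \<mu>_def)
  moreover have "AE x in \<mu>. x \<in> S"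
  proof -
    have "AE x in \<mu>. x \<in> T"
      unfolding \<mu>_def using T(1) supp by (subst AE_distr_iff) (auto simp: AE_measure_pmf_iff finite_imp_closed)
    then show ?thesis using T(2) by auto
  qed
  moreover have "barycenter \<mu> = c"
  proof -
    have "barycenter \<mu> = (\<integral>x. x \<partial>measure_pmf p)"
      unfolding barycenter_def \<mu>_def by (subst integral_distr) auto
    also have "\<dots> = (\<Sum>x\<in>T. pmf p x *\<^sub>R x)"
      using T(1) supp by (intro integral_measure_pmf) auto
    finally show ?thesis using T(5) by (simp add: p w_def)
  qed
  ultimately show thesis by (rule that)
qed

lemma exists_measure_on_contact_points:
  fixes K :: "'a::euclidean_space set"
  assumes "compact K" "K \<noteq> {}" "smallest_cball K c R"
  obtains \<mu> where "\<mu> \<in> prob_measures_on K" "AE x in \<mu>. x \<in> sphere c R" "barycenter \<mu> = c"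
proof -
  obtain \<mu> where \<mu>: "prob_space \<mu>" "sets \<mu> = sets borel" "AE x in \<mu>. x \<in> K \<inter> sphere c R"
    "barycenter \<mu> = c"
    using convex_hull_barycenter[OF center_in_hull_of_contact_points[OF assms]] by metis
  have "- K \<in> sets \<mu>" using compact_imp_closed[OF assms(1)] \<mu>(2) by auto
  moreover have "AE x in \<mu>. x \<notin> - K" using \<mu>(3) by auto
  ultimately have "emeasure \<mu> (- K) = 0" by (simp add: AE_iff_measurable[of "- K"] 
     sets_eq_imp_space_eq[OF \<mu>(2)] Compl_eq)
  then have "\<mu> \<in> prob_measures_on K" using \<mu> by (simp add: prob_measures_on_def)
  then show thesis using \<mu>(3,4) by (intro that[of \<mu>]) auto
qed

section \<open>The variance bound and the maximizers\<close>

text \<open>By \<open>biconjugate_phi\<close> the bound is the infimum over \<open>c\<close> of what \<open>variance_in_ball\<close> gives for the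
  least ball around \<open>c\<close> that contains \<open>K\<close>. A minimizing center supplies the ball in the equality case;
  conversely a ball with the mass on its sphere gives exactly the variance.\<close>

lemma variance_bound:
  fixes K :: "'a::euclidean_space set"
  assumes "compact K" "K \<noteq> {}" "\<mu> \<in> prob_measures_on K"
  defines "bound \<equiv> - ereal ((norm (barycenter \<mu>))\<^sup>2)
             - legendre_fenchel (legendre_fenchel (phi K)) (barycenter \<mu>)"
  shows "ereal (vector_variance \<mu>) \<le> bound"
    and "barycenter \<mu> \<in> interior (closed_convex_hull K) \<Longrightarrow>
      ereal (vector_variance \<mu>) = bound \<longleftrightarrow>
        (\<exists>c r. 0 \<le> r \<and> K \<subseteq> cball c r \<and> (AE x in \<mu>. x \<in> sphere c r))"
proof -
  define z where "z = barycenter \<mu>"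
  define V where "V = vector_variance \<mu>"
  let ?h = "\<lambda>c. farthest_sq K c - (norm (z - c))\<^sup>2"
  let ?q = "legendre_fenchel (legendre_fenchel (phi K)) z"
  have bic: "?q = (SUP c. ereal (- ?h c - (norm z)\<^sup>2))"
    unfolding biconjugate_phi[OF assms(1,2)] by (simp add: algebra_simps)
  have Vh: "V \<le> ?h c" for c
    using variance_in_ball(1)[OF assms(3,1) _ subset_cball_farthest_sq(2)[OF assms(1,2)], of c]
      subset_cball_farthest_sq(1)[OF assms(1,2), of c]
    by (simp add: V_def z_def)
  have upper: "?q \<le> ereal (- v - (norm z)\<^sup>2)" if "\<And>c. v \<le> ?h c" for v
    unfolding bic
  proof (intro SUP_least)
    fix c show "ereal (- ?h c - (norm z)\<^sup>2) \<le> ereal (- v - (norm z)\<^sup>2)"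
      using that[of c] by simp
  qed
  have "?q \<le> ereal (- V - (norm z)\<^sup>2)"
    by (rule upper[OF Vh])
  moreover have lower: "ereal (- ?h c - (norm z)\<^sup>2) \<le> ?q" for c
    unfolding bic by (rule SUP_upper) simp
  ultimately obtain q where q: "?q = ereal q" "q \<le> - V - (norm z)\<^sup>2"
    using lower[of z] by (cases ?q) auto
  have bound: "bound = ereal (- (norm z)\<^sup>2 - q)"
    unfolding bound_def z_def[symmetric] q(1) by simp
  show "ereal (vector_variance \<mu>) \<le> bound"
    using q(2) by (simp add: bound V_def)
  show "ereal (vector_variance \<mu>) = bound \<longleftrightarrow>
      (\<exists>c r. 0 \<le> r \<and> K \<subseteq> cball c r \<and> (AE x in \<mu>. x \<in> sphere c r))"
    if interior: "barycenter \<mu> \<in> interior (closed_convex_hull K)"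
  proof
    assume "ereal (vector_variance \<mu>) = bound"
    then have V: "V = - (norm z)\<^sup>2 - q" by (simp add: bound V_def)
    obtain c where c: "\<And>c'. ?h c \<le> ?h c'"
      using farthest_sq_gap_attains_inf[OF assms(1,2) interior[folded z_def]] by blast
    have "?q \<le> ereal (- ?h c - (norm z)\<^sup>2)"
      by (rule upper[OF c])
    then have "V = ?h c" using Vh[of c] V q(1) by simp
    then have "V + (norm (z - c))\<^sup>2 = (sqrt (farthest_sq K c))\<^sup>2"
      using subset_cball_farthest_sq(1)[OF assms(1,2), of c] by simp
    moreover have r: "0 \<le> sqrt (farthest_sq K c)" "K \<subseteq> cball c (sqrt (farthest_sq K c))"
      using subset_cball_farthest_sq[OF assms(1,2), of c] by auto
    ultimately have "AE x in \<mu>. x \<in> sphere c (sqrt (farthest_sq K c))"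
      using variance_in_ball(2)[OF assms(3,1) r] by (simp add: V_def z_def)
    then show "\<exists>c r. 0 \<le> r \<and> K \<subseteq> cball c r \<and> (AE x in \<mu>. x \<in> sphere c r)"
      using r by blast
  next
    assume "\<exists>c r. 0 \<le> r \<and> K \<subseteq> cball c r \<and> (AE x in \<mu>. x \<in> sphere c r)"
    then obtain c r where r: "0 \<le> r" "K \<subseteq> cball c r" "AE x in \<mu>. x \<in> sphere c r" by blast
    then have "V + (norm (z - c))\<^sup>2 = r\<^sup>2"
      using variance_in_ball(2)[OF assms(3,1) r(1,2)] by (simp add: V_def z_def)
    then have "?h c \<le> V" using farthest_sq_le[OF assms(1,2) r(2)] by simp
    then have "- V - (norm z)\<^sup>2 \<le> q" using lower[of c] q(1) by simp
    then show "ereal (vector_variance \<mu>) = bound"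
      using q(2) by (simp add: bound V_def)
  qed
qed

text \<open>The measure on the contact points shows that the upper bound \<open>R\<^sup>2\<close> is a maximum. A measure of
  variance \<open>R\<^sup>2\<close> leaves no room for the term \<open>|z - c|\<^sup>2\<close> of its barycenter \<open>z\<close>, and is in the
  equality case of \<open>variance_in_ball\<close>.\<close>

lemma maximal_variance_iff:
  fixes K :: "'a::euclidean_space set"
  assumes "compact K" "K \<noteq> {}" "smallest_cball K c R" "\<mu> \<in> prob_measures_on K"
  shows "(\<forall>\<nu> \<in> prob_measures_on K. vector_variance \<nu> \<le> vector_variance \<mu>)
      \<longleftrightarrow> vector_variance \<mu> = R\<^sup>2"
    and "vector_variance \<mu> = R\<^sup>2 \<longleftrightarrow> (AE x in \<mu>. x \<in> sphere c R) \<and> barycenter \<mu> = c"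
proof -
  have R: "0 \<le> R" "K \<subseteq> cball c R" using assms(3) by (auto simp: smallest_cball_def)
  note ball = variance_in_ball[OF _ assms(1) R]
  have le: "vector_variance \<nu> \<le> R\<^sup>2" if "\<nu> \<in> prob_measures_on K" for \<nu>
    using ball(1)[OF that] zero_le_power2[of "norm (barycenter \<nu> - c)"] by linarith
  obtain \<nu> where \<nu>: "\<nu> \<in> prob_measures_on K" "AE x in \<nu>. x \<in> sphere c R" "barycenter \<nu> = c"
    using exists_measure_on_contact_points[OF assms(1-3)] by metis
  have "vector_variance \<nu> = R\<^sup>2" using ball(2)[OF \<nu>(1)] \<nu>(2,3) by simp
  then show "(\<forall>\<nu> \<in> prob_measures_on K. vector_variance \<nu> \<le> vector_variance \<mu>)
      \<longleftrightarrow> vector_variance \<mu> = R\<^sup>2"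
    using le \<nu>(1) assms(4) by (metis antisym)
  show "vector_variance \<mu> = R\<^sup>2 \<longleftrightarrow> (AE x in \<mu>. x \<in> sphere c R) \<and> barycenter \<mu> = c"
  proof
    assume V: "vector_variance \<mu> = R\<^sup>2"
    then have "(norm (barycenter \<mu> - c))\<^sup>2 \<le> 0" using ball(1)[OF assms(4)] by simp
    then have "barycenter \<mu> = c" by simp
    then show "(AE x in \<mu>. x \<in> sphere c R) \<and> barycenter \<mu> = c"
      using ball(2)[OF assms(4)] V by simp
  next
    assume "(AE x in \<mu>. x \<in> sphere c R) \<and> barycenter \<mu> = c"
    then show "vector_variance \<mu> = R\<^sup>2" using ball(2)[OF assms(4)] by simp
  qed
qed

theorem theorem1p1:
  fixes K :: "(real ^ 'n) set"
  assumes "compact K" and "K \<noteq> {}"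
  shows
    \<comment> \<open>(a)\<close>
    "(\<forall>\<mu> \<in> prob_measures_on K.
        ereal (vector_variance \<mu>)
          \<le> - ereal ((norm (barycenter \<mu>))\<^sup>2)
             - legendre_fenchel (legendre_fenchel (phi K)) (barycenter \<mu>)
      \<and> (barycenter \<mu> \<in> interior (closed_convex_hull K) \<longrightarrow>
          (ereal (vector_variance \<mu>)
             = - ereal ((norm (barycenter \<mu>))\<^sup>2)
               - legendre_fenchel (legendre_fenchel (phi K)) (barycenter \<mu>)
           \<longleftrightarrow> (\<exists>c r. 0 \<le> r \<and> K \<subseteq> cball c r \<and> emeasure \<mu> (- frontier (cball c r)) = 0))
        \<and> (ereal (vector_variance \<mu>)
             = - ereal ((norm (barycenter \<mu>))\<^sup>2)
               - legendre_fenchel (legendre_fenchel (phi K)) (barycenter \<mu>)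
           \<longleftrightarrow> (\<exists>c r. 0 \<le> r \<and> K \<subseteq> cball c r
                     \<and> emeasure \<mu> (K \<inter> frontier (cball c r)) = 1))))
    \<and>
    \<comment> \<open>(b)\<close>
    (\<forall>c R. smallest_cball K c R \<longrightarrow>
      (\<forall>\<mu> \<in> prob_measures_on K.
        ((\<forall>\<nu> \<in> prob_measures_on K. vector_variance \<nu> \<le> vector_variance \<mu>)
           \<longleftrightarrow> emeasure \<mu> (K \<inter> frontier (cball c R)) = 1 \<and> barycenter \<mu> = c)
      \<and> ((\<forall>\<nu> \<in> prob_measures_on K. vector_variance \<nu> \<le> vector_variance \<mu>)
           \<longrightarrow> vector_variance \<mu> = R\<^sup>2)))"
proof -
  note on_sphere = on_sphere_conditions[OF _ assms(1)]
  show ?thesis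
    using variance_bound[OF assms] maximal_variance_iff[OF assms]
    by (simp add: on_sphere del: frontier_cball)
qed

end
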